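(* Let $I$ be a finite set and $K$ a finite nonempty set, let $g_i\in\mathbb{Z}[X]$, $i\in I$, be polynomials irreducible in $\mathbb{Z}[X]$, and let $p_k$, $k\in K$, be distinct prime integers. Put $g(X)=\prod_{i\in I}g_i(X)$ and $d=\prod_{k\in K}p_k$, assume that $d$ is coprime to the content of $g$, and suppose that $$f(X)=\frac{g(X)}{d}=\frac{\prod_{i\in I}g_i(X)}{\prod_{k\in K}p_k}$$ is an image primitive integer-valued polynomial. Let $\mathcal{G}=\{g_i(X)\}_{i\in I}$ and $\mathcal{P}=\{p_k\}_{k\in K}$. Then $f(X)$ is irreducible in $\mathrm{Int}(\mathbb{Z})$ if and only if for every family $\mathcal{J}=\{J_k\}_{k\in K}$ of minimal $\mathcal{P}$-coverings for $\mathcal{G}$ the following two conditions hold: i) $I=I_{\mathcal{J},K}$; ii) there is no non-trivial partition $K=K_1\,\dot\cup\,K_2$ (i.e. $K_1,K_2$ disjoint and both nonempty) such that $I_{\mathcal{J},K_1}\cap I_{\mathcal{J},K_2}=\emptyset$.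
   Context: $\mathrm{Int}(\mathbb{Z})=\{f\in\mathbb{Q}[X] : f(\mathbb{Z})\subset\mathbb{Z}\}$ is the ring of integer-valued polynomials; its units are $\pm1$. For $f\in\mathrm{Int}(\mathbb{Z})$, the fixed divisor $d(f)$ is the g.c.d. of $\{f(n): n\in\mathbb{Z}\}$, and $f$ is image primitive if $d(f)=1$. The content of a polynomial in $\mathbb{Z}[X]$ is the g.c.d. of its coefficients. For $g\in\mathbb{Z}[X]$ and a prime $p$, $C_{p,g}=\{j\in\{0,\ldots,p-1\} : p\mid g(j)\}$. Given an indexed family $\mathcal{G}=\{g_i\}_{i\in I}$ of polynomials in $\mathbb{Z}[X]$ (repetitions allowed), a $p$-covering for $\mathcal{G}$ is a subset $J\subseteq I$ such that $\bigcup_{i\in J}C_{p,g_i}=\{0,\ldots,p-1\}$ (with the convention that $C_{p,g_i}\neq\emptyset$ for each $i\in J$); it is minimal if no proper subset of $J$ is a $p$-covering. Given a set $\mathcal{P}=\{p_k\}_{k\in K}$ of distinct primes, a family of minimal $\mathcal{P}$-coverings for $\mathcal{G}$ is a family $\mathcal{J}=\{J_k\}_{k\in K}$ such that for each $k\in K$, $J_k\subseteq I$ is a minimal $p_k$-covering for $\mathcal{G}$. For $T\subseteq K$ set $I_{\mathcal{J},T}=\bigcup_{k\in T}J_k$. *)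

theory Defs
  imports "HOL-Computational_Algebra.Computational_Algebra"
begin

text \<open>The ring \<open>Int(\<int>)\<close>, as a type, so that \<open>irreducible\<close> and \<open>is_unit\<close>
  refer to divisibility inside \<open>Int(\<int>)\<close> and not inside \<open>\<rat>[X]\<close>.\<close>

typedef int_valued_poly = "{f :: rat poly. poly f ` \<int> \<subseteq> \<int>}"
  morphisms rat_poly_of Abs_int_valued_poly
  by (rule exI[of _ 0]) auto

setup_lifting type_definition_int_valued_poly

instantiation int_valued_poly :: idom
begin

lift_definition zero_int_valued_poly :: int_valued_poly is 0
  by auto

lift_definition one_int_valued_poly :: int_valued_poly is 1
  by auto

lift_definition plus_int_valued_poly :: "int_valued_poly \<Rightarrow> int_valued_poly \<Rightarrow> int_valued_poly" is "(+)"
  by (auto simp: image_subset_iff)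

lift_definition minus_int_valued_poly :: "int_valued_poly \<Rightarrow> int_valued_poly \<Rightarrow> int_valued_poly" is "(-)"
  by (auto simp: image_subset_iff)

lift_definition uminus_int_valued_poly :: "int_valued_poly \<Rightarrow> int_valued_poly" is uminus
  by (auto simp: image_subset_iff)

lift_definition times_int_valued_poly :: "int_valued_poly \<Rightarrow> int_valued_poly \<Rightarrow> int_valued_poly" is "(*)"
  by (auto simp: image_subset_iff)

instance
  by standard (transfer; simp add: algebra_simps)+

end

definition fixed_divisor :: "int_valued_poly \<Rightarrow> int" where
  "fixed_divisor f = Gcd {m. \<exists>n::int. of_int m = poly (rat_poly_of f) (of_int n)}"

definition image_primitive :: "int_valued_poly \<Rightarrow> bool" where
  "image_primitive f \<longleftrightarrow> fixed_divisor f = 1"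

definition root_residues :: "int \<Rightarrow> int poly \<Rightarrow> int set" where
  "root_residues p g = {j \<in> {0..<p}. p dvd poly g j}"

definition is_covering :: "int \<Rightarrow> 'i set \<Rightarrow> ('i \<Rightarrow> int poly) \<Rightarrow> 'i set \<Rightarrow> bool" where
  "is_covering p I g J \<longleftrightarrow>
     J \<subseteq> I \<and> (\<forall>i\<in>J. root_residues p (g i) \<noteq> {}) \<and> (\<Union>i\<in>J. root_residues p (g i)) = {0..<p}"

definition is_minimal_covering :: "int \<Rightarrow> 'i set \<Rightarrow> ('i \<Rightarrow> int poly) \<Rightarrow> 'i set \<Rightarrow> bool" where
  "is_minimal_covering p I g J \<longleftrightarrow>
     is_covering p I g J \<and> (\<forall>J'. J' \<subset> J \<longrightarrow> \<not> is_covering p I g J')"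

text \<open>Values of \<open>J\<close> outside \<open>K\<close> are irrelevant.\<close>

definition minimal_covering_family ::
  "'k set \<Rightarrow> ('k \<Rightarrow> int) \<Rightarrow> 'i set \<Rightarrow> ('i \<Rightarrow> int poly) \<Rightarrow> ('k \<Rightarrow> 'i set) \<Rightarrow> bool" where
  "minimal_covering_family K p I g J \<longleftrightarrow> (\<forall>k\<in>K. is_minimal_covering (p k) I g (J k))"

definition family_support :: "('k \<Rightarrow> 'i set) \<Rightarrow> 'k set \<Rightarrow> 'i set" where
  "family_support J T = (\<Union>k\<in>T. J k)"

end

theory Submission
  imports Defs
begin

text \<open>By Gauss's lemma a factorization of \<open>f = g / d\<close> in \<open>Int(\<int>)\<close> has, up to signs, the form
  \<open>(\<Prod>i\<in>I1. g i) / (\<Prod>k\<in>K1. p k)\<close> times \<open>(\<Prod>i\<in>I2. g i) / (\<Prod>k\<in>K2. p k)\<close> for partitions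
  \<open>I = I1 \<union> I2\<close> and \<open>K = K1 \<union> K2\<close>: image primitivity forces the numerators of the rational
  contents of the two factors to be units, and the denominators multiply to \<open>\<plusminus>d\<close>. Such a quotient
  is integer-valued iff for each \<open>k \<in> K1\<close> the family \<open>g\<close> restricted to \<open>I1\<close> contains a minimal
  \<open>p k\<close>-covering (and likewise for the other factor), so factorizations correspond to families of
  minimal coverings whose supports can be separated.\<close>

section \<open>Integer polynomials viewed as rational polynomials\<close>

lemma map_poly_of_int_mult:
  "map_poly of_int (A * B) = (map_poly of_int A * map_poly of_int B :: rat poly)"
  by (rule poly_eqI) (simp add: coeff_map_poly coeff_mult)

lemma map_poly_of_int_smult:
  "map_poly of_int (smult c A) = (smult (of_int c) (map_poly of_int A) :: rat poly)"
  by (rule poly_eqI) (simp add: coeff_map_poly)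

lemma map_poly_of_int_eq_iff:
  "(map_poly of_int A :: rat poly) = map_poly of_int B \<longleftrightarrow> A = B"
  by (auto simp: poly_eq_iff coeff_map_poly)

lemma poly_map_poly_of_int:
  "poly (map_poly of_int A) (of_int n :: rat) = of_int (poly A n)"
  by (induction A) (auto simp: map_poly_pCons)

lemma poly_diff_dvd:
  fixes A :: "'a::comm_ring_1 poly"
  shows "x - y dvd poly A x - poly A y"
proof (induction A)
  case (pCons a A)
  have "poly (pCons a A) x - poly (pCons a A) y = x * (poly A x - poly A y) + (x - y) * poly A y"
    by (simp add: algebra_simps)
  with pCons.IH show ?case by (metis dvd_add dvd_mult dvd_triv_left)
qed simp

text \<open>The congruence \<open>n = n mod q\<close> modulo \<open>q\<close> is preserved by
  integer polynomials; so divisibility of a value by \<open>q\<close> can be tested on the residues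
  \<open>0, ..., q - 1\<close>.\<close>

lemma dvd_poly_mod_iff:
  fixes A :: "int poly"
  shows "q dvd poly A (n mod q) \<longleftrightarrow> q dvd poly A n"
proof -
  have "q dvd n - n mod q" by (simp add: minus_mod_eq_mult_div)
  then have "q dvd poly A n - poly A (n mod q)"
    using poly_diff_dvd[of n "n mod q" A] by (rule dvd_trans)
  then show ?thesis by (metis dvd_diff_right_iff dvd_diff_left_iff)
qed

section \<open>Denominators and contents of rational polynomials\<close>

lemma rat_poly_clear_denominators:
  fixes r :: "rat poly"
  obtains A m where "m > 0" "r = smult (1 / of_int m) (map_poly of_int A)"
proof -
  have "\<exists>A m. m > 0 \<and> r = smult (1 / of_int m) (map_poly of_int A)"
  proof (induction r)
    case 0
    show ?case by (rule exI[of _ 0], rule exI[of _ 1]) simp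
  next
    case (pCons c r)
    then obtain A m where A: "m > 0" "r = smult (1 / of_int m) (map_poly of_int A)" by blast
    obtain u v where c: "c = Rat.Fract u v" "v > 0" by (cases c rule: Rat_cases) auto
    have "pCons c r = smult (1 / of_int (m * v)) (map_poly of_int (pCons (u * m) (smult v A)))"
      using A c by (simp add: map_poly_pCons map_poly_of_int_smult Fract_of_int_quotient)
    moreover have "m * v > 0" using A c by simp
    ultimately show ?case by blast
  qed
  then show ?thesis using that by blast
qed

text \<open>Clear denominators, split off the content of the resulting integer polynomial, and put
  the remaining scalar in lowest terms.\<close>

lemma rat_poly_primitive_decomp:
  fixes r :: "rat poly"
  assumes "r \<noteq> 0"
  obtains A u v where "content A = 1" "v > 0" "coprime u v"
    "r = smult (of_int u / of_int v) (map_poly of_int A)"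
proof -
  obtain B m where B: "m > 0" "r = smult (1 / of_int m) (map_poly of_int B)"
    by (rule rat_poly_clear_denominators)
  have "B \<noteq> 0" using B assms by auto
  obtain u v where uv: "of_int (content B) / (of_int m :: rat) = Rat.Fract u v" "v > 0" "coprime u v"
    by (cases "of_int (content B) / (of_int m :: rat)" rule: Rat_cases) auto
  have "r = smult (1 / of_int m) (map_poly of_int (smult (content B) (primitive_part B)))"
    using B by simp
  also have "\<dots> = smult (of_int (content B) / of_int m) (map_poly of_int (primitive_part B))"
    unfolding map_poly_of_int_smult by simp
  also have "\<dots> = smult (of_int u / of_int v) (map_poly of_int (primitive_part B))"
    unfolding uv by (simp add: Fract_of_int_quotient)
  finally show ?thesis
    using that[of "primitive_part B" v u] uv \<open>B \<noteq> 0\<close> by simp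
qed

section \<open>Products of prime elements\<close>

text \<open>Induction on \<open>I\<close>: each prime \<open>h i\<close> divides \<open>a\<close> or
  \<open>b\<close> and is cancelled there. It serves both for the primes \<open>p k\<close> in the
  integers and for the \<open>g i\<close> in \<int>[X]; the unit \<open>w\<close> leaves room for a
  sign.\<close>

lemma prime_elem_prod_factor_split:
  fixes h :: "'i \<Rightarrow> 'a::algebraic_semidom"
  assumes "finite I" "\<And>i. i \<in> I \<Longrightarrow> prime_elem (h i)" "is_unit w" "a * b = w * prod h I"
  obtains I1 I2 u v where "I = I1 \<union> I2" "I1 \<inter> I2 = {}" "is_unit u" "is_unit v"
    "a = u * prod h I1" "b = v * prod h I2"
proof -
  have "\<exists>I1 I2 u v. I = I1 \<union> I2 \<and> I1 \<inter> I2 = {} \<and> is_unit u \<and> is_unit v \<and>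
    a = u * prod h I1 \<and> b = v * prod h I2"
    using assms
  proof (induction I arbitrary: a b rule: finite_induct)
    case empty
    then have "is_unit (a * b)" by simp
    then have "is_unit a" "is_unit b" by (auto simp: is_unit_mult_iff)
    then show ?case
      by (intro exI[of _ "{}"] exI[of _ a] exI[of _ b]) auto
  next
    case (insert i I)
    have pe: "prime_elem (h i)" and nz: "h i \<noteq> 0" using insert.prems(1)[of i] by auto
    have eq: "a * b = h i * (w * prod h I)" using insert by (simp add: algebra_simps)
    then have "h i dvd a * b" by simp
    then consider c where "a = h i * c" | c where "b = h i * c"
      using pe by (metis dvdE prime_elem_dvd_multD)
    then show ?case
    proof cases
      case 1
      then have "c * b = w * prod h I" using eq nz by (simp add: mult.assoc)
      then obtain I1 I2 u v where s: "I = I1 \<union> I2" "I1 \<inter> I2 = {}" "is_unit u" "is_unit v"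
        "c = u * prod h I1" "b = v * prod h I2"
        using insert.IH[of c b] insert.prems by blast
      have "finite I1" "i \<notin> I1" "i \<notin> I2" using s(1) insert.hyps by auto
      then have "a = u * prod h (insert i I1)" using 1 s(5) by (simp add: mult.left_commute)
      moreover have "insert i I = insert i I1 \<union> I2" "insert i I1 \<inter> I2 = {}"
        using s(1,2) \<open>i \<notin> I2\<close> by auto
      ultimately show ?thesis using s(3,4,6) by blast
    next
      case 2
      then have "h i * (a * c) = h i * (w * prod h I)" using eq by (simp add: ac_simps)
      then have "a * c = w * prod h I" using nz by simp
      then obtain I1 I2 u v where s: "I = I1 \<union> I2" "I1 \<inter> I2 = {}" "is_unit u" "is_unit v"
        "a = u * prod h I1" "c = v * prod h I2"
        using insert.IH[of a c] insert.prems by blast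
      have "finite I2" "i \<notin> I1" "i \<notin> I2" using s(1) insert.hyps by auto
      then have "b = v * prod h (insert i I2)" using 2 s(6) by (simp add: mult.left_commute)
      moreover have "insert i I = I1 \<union> insert i I2" "I1 \<inter> insert i I2 = {}"
        using s(1,2) \<open>i \<notin> I1\<close> by auto
      ultimately show ?thesis using s(3-5) by blast
    qed
  qed
  then show ?thesis using that by blast
qed

text \<open>Distinct primes are coprime, so their divisibilities multiply.\<close>

lemma prod_distinct_primes_dvd:
  fixes p :: "'k \<Rightarrow> int"
  assumes "finite K" "\<And>k. k \<in> K \<Longrightarrow> prime (p k)" "inj_on p K" "\<And>k. k \<in> K \<Longrightarrow> p k dvd x"
  shows "prod p K dvd x"
  using assms
proof (induction K rule: finite_induct)
  case (insert k K)
  have "coprime (p k) (prod p K)"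
    using insert.prems insert.hyps
    by (intro prod_coprime_right primes_coprime) (auto simp: inj_on_def)
  moreover have "prod p K dvd x" using insert by auto
  ultimately show ?case using insert by (simp add: divides_mult)
qed simp

section \<open>Coverings and primes dividing all values of a product\<close>

text \<open>The residue of \<open>n\<close> modulo \<open>q\<close> is a root of some covering
  polynomial, and this polynomial is one of the factors.\<close>

lemma covering_dvd_poly_prod:
  fixes g :: "'i \<Rightarrow> int poly"
  assumes "is_covering q I g J" "J \<subseteq> S" "finite S" "q > 0"
  shows "q dvd poly (prod g S) n"
proof -
  have "n mod q \<in> {0..<q}" using assms by simp
  then obtain i where i: "i \<in> J" "n mod q \<in> root_residues q (g i)"
    using assms unfolding is_covering_def by (metis (no_types, lifting) UN_E)
  then have "q dvd poly (g i) n" by (simp add: root_residues_def dvd_poly_mod_iff)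
  moreover have "poly (g i) n dvd (\<Prod>i\<in>S. poly (g i) n)"
    using i assms by (intro dvd_prodI) auto
  ultimately show ?thesis unfolding poly_prod by (rule dvd_trans)
qed

text \<open>At each residue the prime \<open>q\<close> divides some factor, so \<open>S\<close>
  contains a covering, and finiteness yields a minimal one. Minimality only compares with subsets of
  \<open>J\<close>, so a covering minimal inside \<open>S\<close> is also minimal inside
  \<open>I\<close>.\<close>

lemma minimal_covering_exists:
  fixes g :: "'i \<Rightarrow> int poly"
  assumes "finite S" "S \<subseteq> I" "prime q" "\<And>n. q dvd poly (prod g S) n"
  shows "\<exists>J\<subseteq>S. is_minimal_covering q I g J"
proof -
  define C where "C = {J. J \<subseteq> S \<and> is_covering q I g J}"
  \<comment> \<open>All of \<open>S\<close> may fail to be a covering, since the convention excludes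
    indices without roots modulo \<open>q\<close>; these are dropped.\<close>
  have "{i\<in>S. root_residues q (g i) \<noteq> {}} \<in> C"
  proof -
    have "\<exists>i\<in>S. n \<in> root_residues q (g i)" if "n \<in> {0..<q}" for n
    proof -
      have "q dvd (\<Prod>i\<in>S. poly (g i) n)" using assms(4)[of n] by (simp add: poly_prod)
      then obtain i where "i \<in> S" "q dvd poly (g i) n"
        using assms(1,3) by (auto simp: prime_dvd_prod_iff)
      then show ?thesis using that by (auto simp: root_residues_def)
    qed
    then have "{0..<q} \<subseteq> (\<Union>i\<in>{i\<in>S. root_residues q (g i) \<noteq> {}}. root_residues q (g i))"
      by fastforce
    moreover have "root_residues q (g i) \<subseteq> {0..<q}" for i by (auto simp: root_residues_def)
    ultimately have "(\<Union>i\<in>{i\<in>S. root_residues q (g i) \<noteq> {}}. root_residues q (g i)) = {0..<q}"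
      by (intro subset_antisym UN_least)
    then show ?thesis using assms(2) by (auto simp: C_def is_covering_def)
  qed
  moreover have "finite C" using assms(1) by (auto simp: C_def)
  ultimately obtain J where J: "J \<in> C" "\<forall>J'\<in>C. J' \<subseteq> J \<longrightarrow> J = J'"
    using finite_has_minimal[of C] by auto
  have "is_minimal_covering q I g J"
    unfolding is_minimal_covering_def
  proof (intro conjI allI impI notI)
    show "is_covering q I g J" using J(1) by (simp add: C_def)
    fix J' assume "J' \<subset> J" "is_covering q I g J'"
    moreover from this have "J' \<in> C" using J(1) by (auto simp: C_def)
    ultimately show False using J(2) by blast
  qed
  then show ?thesis using J(1) by (auto simp: C_def)
qed

section \<open>Units, quotients and values in the ring of integer-valued polynomials\<close>

lemma rat_poly_of_eval_int: "\<exists>m. poly (rat_poly_of a) (of_int n) = of_int m"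
proof -
  have "poly (rat_poly_of a) (of_int n) \<in> \<int>"
    using rat_poly_of[of a] by (simp add: image_subset_iff)
  then show ?thesis by (elim Ints_cases) blast
qed

lemma int_valued_poly_unitD:
  assumes "a dvd 1"
  obtains e :: int where "is_unit e" "rat_poly_of a = [:of_int e:]"
proof -
  from assms obtain b where "a * b = 1" by (metis dvdE)
  then have eq: "rat_poly_of a * rat_poly_of b = 1"
    by (metis times_int_valued_poly.rep_eq one_int_valued_poly.rep_eq)
  then have "is_unit (rat_poly_of a)" by (metis dvd_triv_left)
  then obtain c where c: "rat_poly_of a = [:c:]" by (auto simp: is_unit_poly_iff)
  \<comment> \<open>Invertibility in \<rat>[X] only gives a rational constant. Evaluating
    \<open>a\<close> and its inverse at 0 gives two integers with product 1.\<close>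
  obtain e where e: "poly (rat_poly_of a) 0 = of_int e"
    using rat_poly_of_eval_int[of a 0] by auto
  obtain e' where e': "poly (rat_poly_of b) 0 = of_int e'"
    using rat_poly_of_eval_int[of b 0] by auto
  have "of_int (e * e') = (1 :: rat)"
    using arg_cong[OF eq, of "\<lambda>r. poly r 0"] e e' by simp
  then have "is_unit e" by (metis dvd_triv_left of_int_eq_1_iff)
  then show ?thesis using that e c by simp
qed

text \<open>The constant is a sign, so \<open>a\<close> is its own inverse.\<close>

lemma int_valued_poly_unitI:
  assumes "is_unit (e :: int)" "rat_poly_of a = [:of_int e:]"
  shows "a dvd 1"
proof -
  have "of_int e * of_int e = (1 :: rat)" using assms(1) by (auto simp: zdvd1_eq abs_if split: if_splits)
  then have "rat_poly_of (a * a) = rat_poly_of 1"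
    using assms(2) by (simp add: times_int_valued_poly.rep_eq one_int_valued_poly.rep_eq one_pCons)
  then have "a * a = 1" by (simp add: rat_poly_of_inject)
  then show ?thesis by (metis dvd_triv_left)
qed

lemma int_valued_quotient:
  assumes "v \<noteq> 0" "\<And>n. v dvd poly A n"
  obtains a where "rat_poly_of a = smult (1 / of_int v) (map_poly of_int A)"
proof -
  have "poly (smult (1 / of_int v) (map_poly of_int A)) (of_int n :: rat) \<in> \<int>" for n
    using assms(2)[of n] assms(1) by (auto simp: poly_map_poly_of_int elim!: dvdE)
  then have "smult (1 / of_int v) (map_poly of_int A) \<in> {f :: rat poly. poly f ` \<int> \<subseteq> \<int>}"
    by (auto elim!: Ints_cases)
  then show ?thesis using that Abs_int_valued_poly_inverse by metis
qed

lemma fixed_divisor_mult_dvd: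
  assumes "\<And>n. \<exists>m. poly (rat_poly_of f) (of_int n) = of_int (c * m)"
  shows "c dvd fixed_divisor f"
  unfolding fixed_divisor_def
proof (rule Gcd_greatest)
  fix x assume "x \<in> {m. \<exists>n::int. of_int m = poly (rat_poly_of f) (of_int n)}"
  then obtain n where "of_int x = poly (rat_poly_of f) (of_int n)" by auto
  with assms[of n] obtain m where "(of_int x :: rat) = of_int (c * m)" by auto
  then have "x = c * m" using of_int_eq_iff by blast
  then show "c dvd x" by simp
qed

lemma content_dvd_poly: "content A dvd poly A n"
proof -
  have "poly A n = content A * poly (primitive_part A) n"
    by (metis content_times_primitive_part poly_smult)
  then show ?thesis by simp
qed

text \<open>Since \<open>v\<close> divides \<open>u * poly A n\<close> and the fraction is in lowest
  terms, \<open>v\<close> divides every value of \<open>A\<close>.\<close>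

lemma int_valued_poly_decomp:
  assumes "a \<noteq> 0"
  obtains A u v where "content A = 1" "v > 0" "\<And>n. v dvd poly A n"
    "rat_poly_of a = smult (of_int u / of_int v) (map_poly of_int A)"
proof -
  have "rat_poly_of a \<noteq> 0"
    using assms by (metis rat_poly_of_inject zero_int_valued_poly.rep_eq)
  then obtain A u v where *: "content A = 1" "v > 0" "coprime u v"
    "rat_poly_of a = smult (of_int u / of_int v) (map_poly of_int A)"
    by (rule rat_poly_primitive_decomp)
  have "v dvd poly A n" for n
  proof -
    obtain m where "poly (rat_poly_of a) (of_int n) = of_int m"
      using rat_poly_of_eval_int by blast
    then have "(of_int (u * poly A n) :: rat) = of_int (m * v)"
      using * by (simp add: poly_map_poly_of_int field_simps)
    then have "u * poly A n = m * v" using of_int_eq_iff by blast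
    then show ?thesis using *(3) by (metis coprime_commute coprime_dvd_mult_right_iff dvd_triv_right)
  qed
  then show ?thesis using that * by blast
qed

section \<open>Factorizations of an image primitive quotient\<close>

locale image_primitive_quotient =
  fixes I :: "'i set" and K :: "'k set"
    and g :: "'i \<Rightarrow> int poly" and p :: "'k \<Rightarrow> int"
    and f :: int_valued_poly
  assumes finite_I: "finite I" and finite_K: "finite K" and K_nonempty: "K \<noteq> {}"
    and irreducible_g: "\<And>i. i \<in> I \<Longrightarrow> irreducible (g i)"
    and prime_p: "\<And>k. k \<in> K \<Longrightarrow> prime (p k)" and inj_p: "inj_on p K"
    and coprime_content: "coprime (\<Prod>k\<in>K. p k) (content (\<Prod>i\<in>I. g i))"
    and rat_poly_f: "rat_poly_of f =
           smult (1 / of_int (\<Prod>k\<in>K. p k)) (map_poly of_int (\<Prod>i\<in>I. g i))"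
    and image_primitive_f: "image_primitive f"
begin

lemma prod_p_pos: "T \<subseteq> K \<Longrightarrow> prod p T > 0"
  using prime_p by (intro prod_pos) (auto dest: prime_gt_0_int)

lemma f_nonzero: "f \<noteq> 0"
proof -
  have "prod g I \<noteq> 0" using finite_I irreducible_g by (auto simp: irreducible_def)
  then have "rat_poly_of f \<noteq> 0"
    using rat_poly_f prod_p_pos[of K] map_poly_of_int_eq_iff[of "prod g I" 0]
    by (simp del: of_int_prod)
  then show ?thesis by (auto simp: zero_int_valued_poly.rep_eq)
qed

lemma dvd_values_imp_unit:
  assumes "\<And>n. \<exists>m. poly (rat_poly_of f) (of_int n) = of_int (c * m)"
  shows "is_unit c"
  using fixed_divisor_mult_dvd[OF assms] image_primitive_f by (simp add: image_primitive_def)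

text \<open>The content divides \<open>prod p K\<close> times each value of \<open>f\<close> and is
  coprime to \<open>prod p K\<close>, so it divides every value of \<open>f\<close>; image
  primitivity makes it a unit.\<close>

lemma content_prod_g: "content (prod g I) = 1"
proof -
  let ?c = "content (prod g I)"
  have "is_unit ?c"
  proof (rule dvd_values_imp_unit)
    fix n
    obtain m where m: "poly (rat_poly_of f) (of_int n) = of_int m"
      using rat_poly_of_eval_int by blast
    then have "(of_int (poly (prod g I) n) :: rat) = of_int (prod p K * m)"
      using rat_poly_f prod_p_pos[of K]
      by (simp add: poly_map_poly_of_int field_simps del: of_int_prod poly_prod)
    then have "poly (prod g I) n = prod p K * m" using of_int_eq_iff by blast
    then have "?c dvd prod p K * m" by (metis content_dvd_poly)
    then have "?c dvd m" using coprime_content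
      by (metis coprime_commute coprime_dvd_mult_right_iff)
    then show "\<exists>m. poly (rat_poly_of f) (of_int n) = of_int (?c * m)" using m by (metis dvdE)
  qed
  then show ?thesis by (metis is_unit_normalize normalize_content)
qed

text \<open>Translates triviality of a factor into combinatorics. If \<open>a\<close> is a unit
  \<open>e\<close>, then \<open>w * prod g S\<close> is the constant \<open>prod p T * e\<close>;
  its content is a unit because \<open>prod g S\<close> divides a polynomial of content 1. So no
  prime \<open>p k\<close> can occur, and then no irreducible \<open>g i\<close> either.\<close>

lemma is_unit_quotient_iff:
  assumes "S \<subseteq> I" "T \<subseteq> K" "is_unit w"
    and a: "rat_poly_of a = smult (of_int w / of_int (prod p T)) (map_poly of_int (prod g S))"
  shows "a dvd 1 \<longleftrightarrow> S = {} \<and> T = {}"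
proof
  assume "a dvd 1"
  then obtain e :: int where e: "is_unit e" "rat_poly_of a = [:of_int e:]"
    by (rule int_valued_poly_unitD)
  have pos: "prod p T > 0" using assms prod_p_pos by blast
  have "map_poly of_int (smult w (prod g S)) = (smult (of_int (prod p T)) (rat_poly_of a))"
    using a pos unfolding map_poly_of_int_smult by (simp del: of_int_prod)
  also have "\<dots> = map_poly of_int [:prod p T * e:]" by (simp add: e map_poly_pCons)
  finally have eq: "smult w (prod g S) = [:prod p T * e:]" by (simp only: map_poly_of_int_eq_iff)
  have "prod g S dvd prod g I" using assms finite_I by (intro prod_dvd_prod_subset) auto
  then have "is_unit (content (prod g S))" using content_dvd_contentI content_prod_g by metis
  then have "is_unit (content (smult w (prod g S)))" using assms by (simp add: content_smult)
  then have "is_unit (prod p T * e)" unfolding eq by simp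
  then have uT: "is_unit (prod p T)" by (simp only: is_unit_mult_iff)
  have "finite T" "finite S" using assms finite_K finite_I finite_subset by blast+
  have "T = {}"
  proof (rule ccontr)
    assume "T \<noteq> {}"
    then obtain k where k: "k \<in> T" by blast
    then have "p k dvd prod p T" using \<open>finite T\<close> by (intro dvd_prodI)
    then have "is_unit (p k)" using uT by (rule dvd_trans)
    moreover have "prime (p k)" using k assms(2) prime_p by blast
    ultimately show False using not_prime_unit by blast
  qed
  moreover have "S = {}"
  proof (rule ccontr)
    assume "S \<noteq> {}"
    then obtain i where i: "i \<in> S" by blast
    then have "g i dvd prod g S" using \<open>finite S\<close> by (intro dvd_prodI)
    also have "\<dots> dvd smult w (prod g S)" by (simp add: dvd_smult)
    also have "\<dots> dvd 1" unfolding eq using e uT by (simp add: is_unit_poly_iff abs_mult)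
    finally show False using i assms irreducible_g[of i] by (auto simp: irreducible_def)
  qed
  ultimately show "S = {} \<and> T = {}" by blast
next
  assume "S = {} \<and> T = {}"
  then have "rat_poly_of a = [:of_int w:]" using a by (simp add: map_poly_pCons one_pCons)
  then show "a dvd 1" using assms int_valued_poly_unitI by blast
qed

lemma not_is_unit_f: "\<not> f dvd 1"
  using is_unit_quotient_iff[of I K 1 f] rat_poly_f K_nonempty by simp

text \<open>Both factors are written over primitive integer polynomials, and the resulting
  identities in \<int> and \<int>[X] are split by unique factorization. The two divisibility
  conclusions keep the integrality of the factors in the form from which coverings are
  extracted.\<close>

lemma factorization_split:
  assumes "f = a * b"
  obtains I1 I2 K1 K2 w w' where "I = I1 \<union> I2" "I1 \<inter> I2 = {}" "K = K1 \<union> K2" "K1 \<inter> K2 = {}"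
    "is_unit w" "is_unit w'"
    "rat_poly_of a = smult (of_int w / of_int (prod p K1)) (map_poly of_int (prod g I1))"
    "rat_poly_of b = smult (of_int w' / of_int (prod p K2)) (map_poly of_int (prod g I2))"
    "\<And>n. prod p K1 dvd poly (prod g I1) n"
    "\<And>n. prod p K2 dvd poly (prod g I2) n"
proof -
  have "a \<noteq> 0" "b \<noteq> 0" using assms f_nonzero by auto
  from \<open>a \<noteq> 0\<close> obtain A u v where A: "content A = 1" "v > 0" "\<And>n. v dvd poly A n"
    "rat_poly_of a = smult (of_int u / of_int v) (map_poly of_int A)"
    by (rule int_valued_poly_decomp) blast
  from \<open>b \<noteq> 0\<close> obtain B r s where B: "content B = 1" "s > 0" "\<And>n. s dvd poly B n"
    "rat_poly_of b = smult (of_int r / of_int s) (map_poly of_int B)"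
    by (rule int_valued_poly_decomp) blast
  have f: "rat_poly_of f = smult (of_int u / of_int v * (of_int r / of_int s)) (map_poly of_int (A * B))"
    unfolding assms times_int_valued_poly.rep_eq A(4) B(4) map_poly_of_int_mult
    by (simp add: mult.commute)
  \<comment> \<open>The values of \<open>A\<close> and \<open>B\<close> absorb the denominators
    \<open>v\<close> and \<open>s\<close>, so \<open>u * r\<close> divides every value of
    \<open>f\<close>.\<close>
  have "is_unit (u * r)"
  proof (rule dvd_values_imp_unit)
    fix n
    obtain \<alpha> \<beta> where "poly A n = v * \<alpha>" "poly B n = s * \<beta>" using A(3)[of n] B(3)[of n] by (metis dvdE)
    then have "poly (rat_poly_of f) (of_int n) = of_int (u * r * (\<alpha> * \<beta>))"
      unfolding f using A(2) B(2) by (simp add: poly_map_poly_of_int)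
    then show "\<exists>m. poly (rat_poly_of f) (of_int n) = of_int (u * r * m)" by blast
  qed
  then have ur: "is_unit u" "is_unit r" unfolding is_unit_mult_iff by blast+
  have "map_poly of_int (smult (u * r * prod p K) (A * B)) =
    smult (of_int (v * s * prod p K)) (rat_poly_of f)"
    unfolding f map_poly_of_int_smult using A(2) B(2) by (simp add: ac_simps del: of_int_prod)
  also have "\<dots> = map_poly of_int (smult (v * s) (prod g I))"
    unfolding rat_poly_f map_poly_of_int_smult using prod_p_pos[of K] by (simp del: of_int_prod)
  finally have eq: "smult (u * r * prod p K) (A * B) = smult (v * s) (prod g I)"
    by (simp only: map_poly_of_int_eq_iff)
  \<comment> \<open>By Gauss's lemma \<open>A * B\<close> has content 1, as does
    \<open>prod g I\<close>, so only the scalars remain.\<close>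
  have "normalize (u * r * prod p K) = normalize (v * s)"
    using arg_cong[OF eq, of content] A(1) B(1) content_prod_g by (simp add: content_smult content_mult)
  then have "\<bar>u\<bar> * \<bar>r\<bar> * prod p K = v * s"
    using A(2) B(2) prod_p_pos[of K] by (simp add: abs_mult)
  moreover have "\<bar>u\<bar> = 1" "\<bar>r\<bar> = 1" using ur by simp_all
  \<comment> \<open>The factor 1 is the unit \<open>w\<close> of
    \<open>prime_elem_prod_factor_split\<close>.\<close>
  ultimately have vs: "v * s = 1 * prod p K" by simp
  then have "smult (prod p K) (smult (u * r) (A * B)) = smult (prod p K) (prod g I)"
    using eq by (simp add: mult.commute)
  then have "smult (u * r) (A * B) = prod g I"
    by (metis prod_p_pos order.refl order_less_irrefl smult_cancel)
  then have "smult (u * r) (smult (u * r) (A * B)) = smult (u * r) (prod g I)" by simp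
  moreover have "u * r * (u * r) = 1" using \<open>is_unit (u * r)\<close>
    by (auto simp: zdvd1_eq abs_if split: if_splits)
  ultimately have AB: "A * B = [:u * r:] * prod g I" by simp
  obtain K1 K2 e e' where K: "K = K1 \<union> K2" "K1 \<inter> K2 = {}" "is_unit e" "is_unit e'"
    "v = e * prod p K1" "s = e' * prod p K2"
    by (rule prime_elem_prod_factor_split[OF finite_K _ _ vs]) (simp_all add: prime_p prime_imp_prime_elem del: prime_elem_iff_prime_abs)
  \<comment> \<open>The denominators and the products of primes are positive, which rules out the
    sign -1.\<close>
  have "e = 1" "e' = 1"
    using K A(2) B(2) prod_p_pos[of K1] prod_p_pos[of K2]
    by (auto simp: zdvd1_eq abs_if zero_less_mult_iff split: if_splits)
  \<comment> \<open>Irreducible elements of the factorial ring \<int>[X] are prime.\<close>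
  obtain I1 I2 U V where I: "I = I1 \<union> I2" "I1 \<inter> I2 = {}" "is_unit U" "is_unit V"
    "A = U * prod g I1" "B = V * prod g I2"
    by (rule prime_elem_prod_factor_split[OF finite_I _ _ AB])
      (use \<open>is_unit (u * r)\<close> in \<open>auto simp: is_unit_poly_iff irreducible_g irreducible_imp_prime_elem\<close>)
  obtain x y where xy: "U = [:x:]" "V = [:y:]" "is_unit x" "is_unit y"
    using I by (auto simp: is_unit_poly_iff)
  show ?thesis
  proof (rule that[of I1 I2 K1 K2 "u * x" "r * y"])
    show "rat_poly_of a = smult (of_int (u * x) / of_int (prod p K1)) (map_poly of_int (prod g I1))"
      using A(4) I(5) xy K \<open>e = 1\<close> by (simp add: map_poly_of_int_smult)
    show "rat_poly_of b = smult (of_int (r * y) / of_int (prod p K2)) (map_poly of_int (prod g I2))"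
      using B(4) I(6) xy K \<open>e' = 1\<close> by (simp add: map_poly_of_int_smult)
    show "prod p K1 dvd poly (prod g I1) n" for n
      using A(3)[of n] I(5) xy K \<open>e = 1\<close> by (simp add: dvd_mult_unit_iff' del: poly_prod)
    show "prod p K2 dvd poly (prod g I2) n" for n
      using B(3)[of n] I(6) xy K \<open>e' = 1\<close> by (simp add: dvd_mult_unit_iff')
  qed (use I K ur xy in \<open>simp_all only: is_unit_mult_iff simp_thms\<close>)
qed

text \<open>The coverings make both partial quotients integer-valued; their product is
  \<open>f\<close>, so one of them is a unit. Either part of either partition may be empty, which
  lets both conditions of the theorem follow from this one statement.\<close>

lemma irreducible_imp_trivial_split:
  assumes "irreducible f" "minimal_covering_family K p I g J"
    and I: "I = I1 \<union> I2" "I1 \<inter> I2 = {}" and K: "K = K1 \<union> K2" "K1 \<inter> K2 = {}"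
    and J: "family_support J K1 \<subseteq> I1" "family_support J K2 \<subseteq> I2"
  shows "I1 = {} \<and> K1 = {} \<or> I2 = {} \<and> K2 = {}"
proof -
  have quot: "\<exists>a. rat_poly_of a = smult (1 / of_int (prod p T)) (map_poly of_int (prod g S))"
    if "S \<subseteq> I" "T \<subseteq> K" "family_support J T \<subseteq> S" for S T
  proof -
    have fin: "finite S" "finite T" using that finite_I finite_K finite_subset by blast+
    have "prod p T dvd poly (prod g S) n" for n
    proof (rule prod_distinct_primes_dvd)
      fix k assume "k \<in> T"
      then show "p k dvd poly (prod g S) n"
        using that assms(2) fin prime_p[of k]
        by (intro covering_dvd_poly_prod[of "p k" I g "J k" S])
          (auto simp: minimal_covering_family_def is_minimal_covering_def family_support_def
            prime_gt_0_int)
    qed (use that fin inj_p prime_p in \<open>auto intro: inj_on_subset\<close>)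
    moreover have "prod p T \<noteq> 0" using prod_p_pos[of T] that by simp
    ultimately show ?thesis by (metis int_valued_quotient)
  qed
  obtain a where a: "rat_poly_of a = smult (1 / of_int (prod p K1)) (map_poly of_int (prod g I1))"
    using quot[of I1 K1] I K J by auto
  obtain b where b: "rat_poly_of b = smult (1 / of_int (prod p K2)) (map_poly of_int (prod g I2))"
    using quot[of I2 K2] I K J by auto
  have "prod g I = prod g I1 * prod g I2" "prod p K = prod p K1 * prod p K2"
    using finite_I finite_K I K by (simp_all add: prod.union_disjoint)
  then have "rat_poly_of f = rat_poly_of (a * b)"
    unfolding rat_poly_f times_int_valued_poly.rep_eq a b
    by (simp add: map_poly_of_int_mult mult.commute)
  then have "f = a * b" by (simp add: rat_poly_of_inject)
  then have "a dvd 1 \<or> b dvd 1" using assms(1) by (auto dest: irreducibleD)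
  then show ?thesis
    using is_unit_quotient_iff[of I1 K1 1 a] is_unit_quotient_iff[of I2 K2 1 b] a b I K by auto
qed

end

section \<open>The covering criterion for irreducibility\<close>

theorem theorem3p1:
  fixes I :: "'i set" and K :: "'k set"
    and g :: "'i \<Rightarrow> int poly" and p :: "'k \<Rightarrow> int"
    and f :: int_valued_poly
  assumes "finite I" and "finite K" and "K \<noteq> {}"
    and "\<And>i. i \<in> I \<Longrightarrow> irreducible (g i)"
    and "\<And>k. k \<in> K \<Longrightarrow> prime (p k)" and "inj_on p K"
    and "coprime (\<Prod>k\<in>K. p k) (content (\<Prod>i\<in>I. g i))"
    and "rat_poly_of f =
           smult (1 / of_int (\<Prod>k\<in>K. p k)) (map_poly of_int (\<Prod>i\<in>I. g i))"
    and "image_primitive f"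
  shows "irreducible f \<longleftrightarrow>
    (\<forall>J. minimal_covering_family K p I g J \<longrightarrow>
       I = family_support J K \<and>
       \<not> (\<exists>K1 K2. K = K1 \<union> K2 \<and> K1 \<inter> K2 = {} \<and> K1 \<noteq> {} \<and> K2 \<noteq> {} \<and>
            family_support J K1 \<inter> family_support J K2 = {}))"
proof -
  interpret image_primitive_quotient I K g p f
    using assms by unfold_locales
  show ?thesis
  proof (intro iffI allI impI conjI)
    fix J assume irr: "irreducible f" and J: "minimal_covering_family K p I g J"
    have sub: "family_support J T \<subseteq> I" if "T \<subseteq> K" for T
      using J that by (fastforce simp: family_support_def minimal_covering_family_def
          is_minimal_covering_def is_covering_def)
    \<comment> \<open>All primes go with the support, and the leftover indices form a factor with
      denominator 1. As \<open>K\<close> is nonempty, it is this second factor that must be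
      trivial.\<close>
    show "I = family_support J K"
      using irreducible_imp_trivial_split[OF irr J, of "family_support J K" "I - family_support J K" K "{}"]
        sub[of K] \<open>K \<noteq> {}\<close> by (auto simp: family_support_def)
    show "\<not> (\<exists>K1 K2. K = K1 \<union> K2 \<and> K1 \<inter> K2 = {} \<and> K1 \<noteq> {} \<and> K2 \<noteq> {} \<and>
            family_support J K1 \<inter> family_support J K2 = {})"
    proof (rule notI, elim exE conjE)
      fix K1 K2 assume K: "K = K1 \<union> K2" "K1 \<inter> K2 = {}" "K1 \<noteq> {}" "K2 \<noteq> {}"
        "family_support J K1 \<inter> family_support J K2 = {}"
      \<comment> \<open>Here \<open>order.refl\<close> fixes \<open>I1\<close> as the support of
        \<open>K1\<close>; its complement contains the support of \<open>K2\<close> by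
        disjointness.\<close>
      have "K1 = {} \<or> K2 = {}"
        using irreducible_imp_trivial_split[OF irr J _ _ K(1,2) order.refl,
            of "I - family_support J K1"] sub[of K1] sub[of K2] K by blast
      then show False using K(3,4) by blast
    qed
  next
    assume cond: "\<forall>J. minimal_covering_family K p I g J \<longrightarrow>
       I = family_support J K \<and>
       \<not> (\<exists>K1 K2. K = K1 \<union> K2 \<and> K1 \<inter> K2 = {} \<and> K1 \<noteq> {} \<and> K2 \<noteq> {} \<and>
            family_support J K1 \<inter> family_support J K2 = {})"
    show "irreducible f"
    proof (rule irreducibleI)
      fix a b assume "f = a * b"
      then obtain I1 I2 K1 K2 w w' where
        I: "I = I1 \<union> I2" "I1 \<inter> I2 = {}" and K: "K = K1 \<union> K2" "K1 \<inter> K2 = {}"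
        and w: "is_unit w" "is_unit w'"
        and a: "rat_poly_of a = smult (of_int w / of_int (prod p K1)) (map_poly of_int (prod g I1))"
        and b: "rat_poly_of b = smult (of_int w' / of_int (prod p K2)) (map_poly of_int (prod g I2))"
        and dvd: "\<And>n. prod p K1 dvd poly (prod g I1) n" "\<And>n. prod p K2 dvd poly (prod g I2) n"
        by (rule factorization_split) blast
      \<comment> \<open>The numerator standing over \<open>p k\<close>: all its values are divisible
        by \<open>p k\<close>, so a minimal covering can be chosen inside it.\<close>
      define side where "side k = (if k \<in> K1 then I1 else I2)" for k
      have "\<exists>J\<subseteq>side k. is_minimal_covering (p k) I g J" if k: "k \<in> K" for k
      proof (rule minimal_covering_exists)
        have "finite K1" "finite K2" using \<open>finite K\<close> K by auto
        then show "p k dvd poly (prod g (side k)) n" for n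
          using k K dvd_trans[OF dvd_prodI[of K1 k p] dvd(1)[of n]]
            dvd_trans[OF dvd_prodI[of K2 k p] dvd(2)[of n]]
          by (auto simp: side_def simp del: poly_prod)
      qed (use \<open>finite I\<close> I prime_p k in \<open>auto simp: side_def\<close>)
      then obtain J where J: "\<And>k. k \<in> K \<Longrightarrow> J k \<subseteq> side k \<and> is_minimal_covering (p k) I g (J k)"
        by metis
      then have fam: "minimal_covering_family K p I g J" by (simp add: minimal_covering_family_def)
      have J1: "family_support J K1 \<subseteq> I1"
        unfolding family_support_def
      proof (rule UN_least)
        fix k assume "k \<in> K1"
        then show "J k \<subseteq> I1" using J[of k] K(1) by (simp add: side_def)
      qed
      have J2: "family_support J K2 \<subseteq> I2"
        unfolding family_support_def
      proof (rule UN_least)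
        fix k assume "k \<in> K2"
        moreover from this have "k \<notin> K1" using K(2) by blast
        ultimately show "J k \<subseteq> I2" using J[of k] K(1) by (simp add: side_def)
      qed
      have "family_support J K = family_support J K1 \<union> family_support J K2"
        unfolding family_support_def K(1) by (rule UN_Un)
      moreover have "I = family_support J K" using cond fam by blast
      ultimately have supp: "I = family_support J K1 \<union> family_support J K2" by (rule trans[rotated])
      have "family_support J K1 \<inter> family_support J K2 = {}" using J1 J2 I(2) by blast
      \<comment> \<open>Condition ii) for this separated family; condition i), already used in
        \<open>supp\<close>, then empties the matching numerator.\<close>
      then have "K1 = {} \<or> K2 = {}" using cond[rule_format, OF fam] K by metis
      then show "a dvd 1 \<or> b dvd 1"
      proof
        assume "K1 = {}"
        then have "family_support J K1 = {}" by (simp add: family_support_def)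
        \<comment> \<open>The support of \<open>K2\<close> is now all of \<open>I\<close> and lies
          in \<open>I2\<close>, which is disjoint from \<open>I1\<close>.\<close>
        then have "I1 = {}" using supp I J2 by blast
        then show ?thesis using is_unit_quotient_iff[OF _ _ w(1) a] \<open>K1 = {}\<close> by simp
      next
        assume "K2 = {}"
        then have "family_support J K2 = {}" by (simp add: family_support_def)
        then have "I2 = {}" using supp I J1 by blast
        then show ?thesis using is_unit_quotient_iff[OF _ _ w(2) b] \<open>K2 = {}\<close> by simp
      qed
    qed (fact f_nonzero not_is_unit_f)+
  qed
qed

end
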